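(* Let $p=q=1/2$, let $X_{n,s}$ be the number of turns required to end the single-player pile game with boundary with set of choices $R=\{1,-1\}$ and target $n$, starting with $s$ chips, $0\le s\le n$, and let $\mu_{n,s}=E[X_{n,s}]$. Then $$\mathrm{Var}[X_{n,s}]=E[(X_{n,s}-\mu_{n,s})^2]=\frac{(n-s)(n+s+1)(2n^2+2n+2s^2+2s-1)}{3},$$ $$E[(X_{n,s}-\mu_{n,s})^3]=\frac{(n-s)(n+s+1)}{15}\Bigl(16n^4+32n^3+8n^2(2s^2+2s+1)+8n(2s^2+2s-1)+16s^4+32s^3+8s^2-8s-3\Bigr).$$
   Context: Single-player pile game with boundary, $R=\{1,-1\}$: the player starts with $s$ chips, $0\le s\le n$. In each turn, independently, with probability $p$ one chip is added, and with probability $q=1-p$ one chip is removed, except that if the player has $0$ chips he stays at $0$ instead. The game ends when the player first has $n$ chips (at turn $0$ if $s=n$). *)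

theory Defs
  imports "HOL-Probability.Probability"
begin

text \<open>
  \<open>r t\<close> is the choice (\<open>1\<close> or \<open>-1\<close>) made in turn \<open>t + 1\<close>, and \<open>chips r s t\<close> is the size of the
  pile after \<open>t\<close> turns.  The recursion is not stopped at the target; this does not affect the
  first time the target is reached.
\<close>

primrec chips :: "(nat \<Rightarrow> int) \<Rightarrow> nat \<Rightarrow> nat \<Rightarrow> int" where
  "chips r s 0 = int s"
| "chips r s (Suc t) =
     (if chips r s t = 0 \<and> r t = -1 then 0 else chips r s t + r t)"

text \<open>The value is \<open>\<infinity>\<close> if the target is never reached.\<close>

definition game_turns :: "nat \<Rightarrow> nat \<Rightarrow> (nat \<Rightarrow> int) \<Rightarrow> enat" where
  "game_turns n s r = Inf {enat t | t. chips r s t = int n}"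

locale pile_game = prob_space M for M :: "'a measure" +
  fixes p :: real and r :: "nat \<Rightarrow> 'a \<Rightarrow> int"
  assumes indep_choices: "indep_vars (\<lambda>_. count_space UNIV) r UNIV"
    and prob_add: "\<And>t. prob {\<omega> \<in> space M. r t \<omega> = 1} = p"
    and prob_remove: "\<And>t. prob {\<omega> \<in> space M. r t \<omega> = -1} = 1 - p"

text \<open>
  The finite part of the number of turns; its value on infinite games is irrelevant whenever the
  game ends almost surely.
\<close>

definition num_turns :: "nat \<Rightarrow> nat \<Rightarrow> (nat \<Rightarrow> 'a \<Rightarrow> int) \<Rightarrow> 'a \<Rightarrow> real" where
  "num_turns n s r \<omega> = real (the_enat (game_turns n s (\<lambda>t. r t \<omega>)))"

end

theory Submission
  imports Defs
begin

text \<open>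
  Let \<open>T\<close> be the number of turns and \<open>C t\<close> the pile after \<open>t\<close> turns.  Let \<open>m k x\<close> be the
  conjectured \<open>k\<close>-th moment of \<open>T\<close> from \<open>x\<close> chips, and let
  \<open>G t x = (\<Sum>j\<le>k. (k choose j) * t ^ (k - j) * m j x)\<close>, the conjectured expectation of
  \<open>T ^ k\<close> given that the game is still running at time \<open>t\<close> with \<open>x\<close> chips.  The moment
  recursion says that \<open>G\<close> is space-time harmonic for the walk, so \<open>G\<close> at the stopped pair
  \<open>(min t T, C (min t T))\<close> has constant expectation \<open>G 0 s = m k s\<close>.  Since \<open>G\<close> dominates
  \<open>t ^ k\<close>, monotone convergence makes \<open>T\<close> almost surely finite and \<open>T ^ k\<close> integrable; since
  \<open>G\<close> is at most a multiple of \<open>1 + t ^ k\<close>, dominated convergence then identifies the moment.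
  The central moments follow from the raw ones for \<open>k = 1, 2, 3\<close>.
\<close>

section \<open>The pile as a deterministic function of the choices\<close>

lemma chips_cong:
  assumes "\<And>i. i < t \<Longrightarrow> r i = r' i"
  shows "chips r s t = chips r' s t"
  using assms by (induction t) auto

lemma chips_nonneg:
  assumes "\<And>i. r i \<in> {1, -1}"
  shows "0 \<le> chips r s t"
proof (induction t)
  case (Suc t)
  then show ?case using assms[of t] by auto
qed simp

text \<open>A turn adds at most one chip, so the pile cannot jump over \<open>n\<close>.\<close>

lemma chips_less_target:
  assumes "\<And>i. r i \<in> {1, -1}" "s \<le> n" "\<And>i. i \<le> t \<Longrightarrow> chips r s i \<noteq> int n"
  shows "chips r s t < int n"
  using assms(3)
proof (induction t)
  case 0
  from 0[of 0] \<open>s \<le> n\<close> show ?case by simp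
next
  case (Suc t)
  have "chips r s t < int n" by (rule Suc.IH) (use Suc.prems in auto)
  moreover have "r t \<le> 1" using assms(1)[of t] by auto
  ultimately show ?case using Suc.prems[of "Suc t"] by (auto split: if_splits)
qed

lemma measurable_chips:
  assumes "\<And>i. i < t \<Longrightarrow> f i \<in> N \<rightarrow>\<^sub>M count_space UNIV"
  shows "(\<lambda>\<omega>. chips (\<lambda>i. f i \<omega>) s t) \<in> N \<rightarrow>\<^sub>M count_space UNIV"
  using assms
proof (induction t)
  case (Suc t)
  have [measurable]: "f t \<in> N \<rightarrow>\<^sub>M count_space UNIV"
    "(\<lambda>\<omega>. chips (\<lambda>i. f i \<omega>) s t) \<in> N \<rightarrow>\<^sub>M count_space UNIV"
    using Suc by auto
  show ?case by simp
qed simp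

section \<open>The first hitting time of the target and the game stopped there\<close>

lemma less_game_turns_iff:
  "enat t < game_turns n s r \<longleftrightarrow> (\<forall>i\<le>t. chips r s i \<noteq> int n)"
proof -
  have "game_turns n s r \<le> enat t \<longleftrightarrow> (\<exists>i\<le>t. chips r s i = int n)"
  proof
    assume le: "game_turns n s r \<le> enat t"
    define A where "A = {enat i | i. chips r s i = int n}"
    \<comment> \<open>In \<open>enat\<close> the infimum of the empty set is infinite, so a finite
      bound forces a hit; the infimum of a nonempty set is attained.\<close>
    have "A \<noteq> {}" using le by (auto simp: game_turns_def A_def[symmetric] top_enat_def)
    then have "Inf A \<in> A" unfolding Inf_enat_def by (auto intro: LeastI)
    with le show "\<exists>i\<le>t. chips r s i = int n"
      by (auto simp: game_turns_def A_def)
  next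
    assume "\<exists>i\<le>t. chips r s i = int n"
    then obtain i where i: "i \<le> t" "chips r s i = int n" by auto
    then have "game_turns n s r \<le> enat i"
      unfolding game_turns_def by (intro Inf_lower) auto
    with i show "game_turns n s r \<le> enat t" by (meson enat_ord_simps(1) order_trans)
  qed
  then show ?thesis by (auto simp: not_le[symmetric])
qed

lemma chips_game_turns:
  assumes "game_turns n s r = enat t"
  shows "chips r s t = int n"
proof -
  obtain i where i: "i \<le> t" "chips r s i = int n"
    using less_game_turns_iff[of t n s r] assms by auto
  have "\<not> i < t"
    using less_game_turns_iff[of i n s r] assms i by auto
  with i show ?thesis by simp
qed

lemma game_turns_eq_enat_iff:
  "game_turns n s r = enat t \<longleftrightarrow> chips r s t = int n \<and> (\<forall>i<t. chips r s i \<noteq> int n)"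
proof
  assume eq: "game_turns n s r = enat t"
  moreover have "\<forall>i<t. enat i < game_turns n s r" using eq by simp
  ultimately show "chips r s t = int n \<and> (\<forall>i<t. chips r s i \<noteq> int n)"
    using chips_game_turns less_game_turns_iff by blast
next
  assume R: "chips r s t = int n \<and> (\<forall>i<t. chips r s i \<noteq> int n)"
  then have le: "game_turns n s r \<le> enat t"
    using less_game_turns_iff[of t n s r] by (auto simp: not_less[symmetric])
  then obtain j where j: "game_turns n s r = enat j" "j \<le> t"
    by (cases "game_turns n s r") auto
  with R chips_game_turns[OF j(1)] show "game_turns n s r = enat t" by (cases "j = t") auto
qed

text \<open>The minimum with \<open>enat t\<close> is finite, so \<open>the_enat\<close> never meets
  infinity, even in a game that does not end.\<close>

definition stopped_time :: "nat \<Rightarrow> nat \<Rightarrow> (nat \<Rightarrow> int) \<Rightarrow> nat \<Rightarrow> nat" where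
  "stopped_time n s r t = the_enat (min (enat t) (game_turns n s r))"

lemma stopped_time_running: "enat t \<le> game_turns n s r \<Longrightarrow> stopped_time n s r t = t"
  by (simp add: stopped_time_def min_absorb1)

lemma stopped_time_finished: "game_turns n s r = enat u \<Longrightarrow> u \<le> t \<Longrightarrow> stopped_time n s r t = u"
  by (simp add: stopped_time_def min_absorb2)

lemma stopped_time_0: "stopped_time n s r 0 = 0"
  by (rule stopped_time_running) (simp add: zero_enat_def[symmetric])

lemma stopped_time_le: "stopped_time n s r t \<le> t"
  by (cases "game_turns n s r") (auto simp: stopped_time_def min_def)

lemma stopped_time_mono: "mono (stopped_time n s r)"
  by (cases "game_turns n s r") (auto simp: stopped_time_def min_def mono_def)

text \<open>Before the hit the pile is below \<open>n\<close>, and from the hit on the stopped pile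
  is frozen at \<open>n\<close>. This is why bounds on \<open>G\<close> are needed for finitely many
  pile sizes only.\<close>

lemma chips_stopped_time_range:
  assumes "\<And>i. r i \<in> {1, -1}" "s \<le> n"
  shows "chips r s (stopped_time n s r t) \<in> {0..int n}"
proof (cases "enat t < game_turns n s r")
  case True
  then show ?thesis
    using stopped_time_running[of t n s r] chips_nonneg[of r s t] assms
      chips_less_target[of r s n t] less_game_turns_iff[of t n s r] by auto
next
  case False
  then obtain u where u: "game_turns n s r = enat u" "u \<le> t"
    by (cases "game_turns n s r") auto
  then show ?thesis
    using chips_game_turns[OF u(1)] stopped_time_finished[OF u] by simp
qed

section \<open>Measurability, and independence of the next choice from the past\<close>

context pile_game
begin

lemma measurable_choice [measurable]: "r t \<in> M \<rightarrow>\<^sub>M count_space UNIV"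
  using indep_choices by (auto simp: indep_vars_def)

text \<open>The probabilities of the two choices add up to 1, so any other value occurs only on a
  null set.\<close>

lemma AE_choices: "AE \<omega> in M. \<forall>t. r t \<omega> \<in> {1, -1}"
proof -
  have "AE \<omega> in M. r t \<omega> \<in> {1, -1}" for t
  proof -
    have "prob {\<omega> \<in> space M. r t \<omega> \<in> {1, -1}} =
        prob ({\<omega> \<in> space M. r t \<omega> = 1} \<union> {\<omega> \<in> space M. r t \<omega> = -1})"
      by (rule arg_cong[where f = prob]) auto
    also have "\<dots> = 1"
      by (subst finite_measure_Union) (auto simp: prob_add prob_remove)
    finally show ?thesis by (subst (asm) prob_Collect_eq_1) auto
  qed
  then show ?thesis by (simp add: AE_all_countable)
qed

lemma measurable_chips_choices [measurable]:
  "(\<lambda>\<omega>. chips (\<lambda>i. r i \<omega>) s t) \<in> M \<rightarrow>\<^sub>M count_space UNIV"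
  by (rule measurable_chips) simp

lemma measurable_game_turns [measurable]:
  "(\<lambda>\<omega>. game_turns n s (\<lambda>i. r i \<omega>)) \<in> M \<rightarrow>\<^sub>M count_space UNIV"
\<comment> \<open>As \<open>enat\<close> is countable, preimages of singletons suffice, and each is
  given by countably many conditions on the pile.\<close>
proof (subst measurable_count_space_eq_countable, safe)
  fix a :: enat
  show "(\<lambda>\<omega>. game_turns n s (\<lambda>i. r i \<omega>)) -` {a} \<inter> space M \<in> sets M"
  proof (cases a)
    case (enat t)
    have "(\<lambda>\<omega>. game_turns n s (\<lambda>i. r i \<omega>)) -` {a} \<inter> space M =
        {\<omega> \<in> space M. chips (\<lambda>i. r i \<omega>) s t = int n \<and> (\<forall>i<t. chips (\<lambda>i. r i \<omega>) s i \<noteq> int n)}"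
      by (auto simp: enat game_turns_eq_enat_iff)
    also have "\<dots> \<in> sets M" by measurable
    finally show ?thesis .
  next
    case infinity
    have "(\<lambda>\<omega>. game_turns n s (\<lambda>i. r i \<omega>)) -` {a} \<inter> space M =
        {\<omega> \<in> space M. \<forall>t. chips (\<lambda>i. r i \<omega>) s t \<noteq> int n}"
    proof -
      have "game_turns n s r' = \<infinity> \<longleftrightarrow> (\<forall>t. chips r' s t \<noteq> int n)" for r'
        using less_game_turns_iff[of _ n s r'] chips_game_turns[of n s r']
        by (cases "game_turns n s r'") auto
      then show ?thesis by (auto simp: infinity)
    qed
    also have "\<dots> \<in> sets M" by measurable
    finally show ?thesis .
  qed
qed auto

lemma measurable_stopped_time [measurable]:
  "(\<lambda>\<omega>. stopped_time n s (\<lambda>i. r i \<omega>) t) \<in> M \<rightarrow>\<^sub>M count_space UNIV"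
  unfolding stopped_time_def by measurable

lemma borel_measurable_num_turns [measurable]: "num_turns n s r \<in> borel_measurable M"
  unfolding num_turns_def[abs_def] by measurable

text \<open>
  \<open>V\<close> depends only on the choices before time \<open>t\<close>.  The restriction to \<open>{0..int n}\<close> makes it
  bounded; it is automatic outside the null set where some choice is neither \<open>1\<close> nor \<open>-1\<close>.
\<close>

lemma expectation_running_mult_choice:
  fixes g :: "int \<Rightarrow> real" and n s t :: nat
  defines "V \<equiv> \<lambda>\<rho>. if (\<forall>i\<le>t. chips \<rho> s i \<noteq> int n) \<and> chips \<rho> s t \<in> {0..int n}
                     then g (chips \<rho> s t) else 0"
  shows "integrable M (\<lambda>\<omega>. V (\<lambda>i. r i \<omega>))"
    and "integrable M (\<lambda>\<omega>. V (\<lambda>i. r i \<omega>) * indicator {c} (r t \<omega>))"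
    and "expectation (\<lambda>\<omega>. V (\<lambda>i. r i \<omega>) * indicator {c} (r t \<omega>)) =
           expectation (\<lambda>\<omega>. V (\<lambda>i. r i \<omega>)) * prob {\<omega> \<in> space M. r t \<omega> = c}"
proof -
  let ?P = "\<lambda>A. Pi\<^sub>M A (\<lambda>_. count_space UNIV) :: (nat \<Rightarrow> int) measure"
  have meas: "V \<in> borel_measurable (?P {..<t})"
  proof -
    have *: "(\<lambda>\<rho>. chips \<rho> s i) \<in> ?P {..<t} \<rightarrow>\<^sub>M count_space UNIV" if "i \<le> t" for i
      using that by (intro measurable_chips[where f = "\<lambda>i \<rho>. \<rho> i"])
        (auto intro!: measurable_component_singleton)
    \<comment> \<open>The product over \<open>{..<t}\<close> carries only the first \<open>t\<close>
      choices, so the pile is known to be measurable for \<open>i \<le> t\<close> only; hence the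
      quantifier bounded by the set \<open>{..t}\<close>.\<close>
    have [measurable]: "Measurable.pred (?P {..<t}) (\<lambda>\<rho>. \<forall>i\<in>{..t}. chips \<rho> s i \<noteq> int n)"
    proof (rule pred_intros_finite)
      fix i assume "i \<in> {..t}"
      then have [measurable]: "(\<lambda>\<rho>. chips \<rho> s i) \<in> ?P {..<t} \<rightarrow>\<^sub>M count_space UNIV"
        using * by simp
      show "Measurable.pred (?P {..<t}) (\<lambda>\<rho>. chips \<rho> s i \<noteq> int n)" by measurable
    qed simp
    have [measurable]: "(\<lambda>\<rho>. chips \<rho> s t) \<in> ?P {..<t} \<rightarrow>\<^sub>M count_space UNIV" using * by simp
    have "V = (\<lambda>\<rho>. if (\<forall>i\<in>{..t}. chips \<rho> s i \<noteq> int n) \<and> chips \<rho> s t \<in> {0..int n}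
                     then g (chips \<rho> s t) else 0)"
      by (auto simp: V_def fun_eq_iff)
    then show ?thesis by simp
  qed
  have V_restrict: "V (restrict \<rho> {..<t}) = V \<rho>" for \<rho>
  proof -
    have "chips (restrict \<rho> {..<t}) s i = chips \<rho> s i" if "i \<le> t" for i
      using that by (intro chips_cong) auto
    moreover from this have "(\<forall>i\<le>t. chips (restrict \<rho> {..<t}) s i \<noteq> int n) \<longleftrightarrow>
        (\<forall>i\<le>t. chips \<rho> s i \<noteq> int n)" by auto
    ultimately show ?thesis by (simp only: V_def order_refl)
  qed
  \<comment> \<open>The past and the next choice live on disjoint index blocks of an independent
    family. By \<open>V_restrict\<close>, \<open>V\<close> factors through the first block.\<close>
  have "indep_var (?P {..<t}) (\<lambda>\<omega>. restrict (\<lambda>i. r i \<omega>) {..<t})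
                  (?P {t}) (\<lambda>\<omega>. restrict (\<lambda>i. r i \<omega>) {t})"
    by (rule indep_var_restrict[OF indep_choices]) auto
  then have "indep_var borel (V \<circ> (\<lambda>\<omega>. restrict (\<lambda>i. r i \<omega>) {..<t}))
      borel ((\<lambda>\<rho>. indicator {c} (\<rho> t) :: real) \<circ> (\<lambda>\<omega>. restrict (\<lambda>i. r i \<omega>) {t}))"
  proof (rule indep_var_compose)
    have [measurable]: "(\<lambda>\<rho>. \<rho> t) \<in> ?P {t} \<rightarrow>\<^sub>M count_space UNIV"
      by (rule measurable_component_singleton) simp
    have [measurable]: "(indicator {c} :: int \<Rightarrow> real) \<in> borel_measurable (count_space UNIV)"
      by simp
    show "(\<lambda>\<rho>. indicator {c} (\<rho> t) :: real) \<in> borel_measurable (?P {t})"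
      by (rule measurable_compose) measurable
  qed (rule meas)
  then have ind: "indep_var borel (\<lambda>\<omega>. V (\<lambda>i. r i \<omega>)) borel (\<lambda>\<omega>. indicator {c} (r t \<omega>) :: real)"
    by (simp add: o_def V_restrict)
  have [measurable]: "(\<lambda>\<omega>. V (\<lambda>i. r i \<omega>)) \<in> borel_measurable M"
    "(\<lambda>\<omega>. indicator {c} (r t \<omega>) :: real) \<in> borel_measurable M"
    using indep_var_rv1[OF ind] indep_var_rv2[OF ind] by auto
  \<comment> \<open>\<open>V\<close> sees only finitely many values of \<open>g\<close>, so the sum
    of their absolute values bounds it uniformly.\<close>
  have "\<bar>V \<rho>\<bar> \<le> (\<Sum>x\<in>{0..int n}. \<bar>g x\<bar>)" for \<rho>
    using member_le_sum[of "chips \<rho> s t" "{0..int n}" "\<lambda>x. \<bar>g x\<bar>"]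
    by (auto simp: V_def intro!: sum_nonneg)
  then show int: "integrable M (\<lambda>\<omega>. V (\<lambda>i. r i \<omega>))"
    by (intro integrable_const_bound[where B = "\<Sum>x\<in>{0..int n}. \<bar>g x\<bar>"]) auto
  have int': "integrable M (\<lambda>\<omega>. indicator {c} (r t \<omega>) :: real)"
    by (intro integrable_const_bound[where B = 1]) auto
  show "integrable M (\<lambda>\<omega>. V (\<lambda>i. r i \<omega>) * indicator {c} (r t \<omega>))"
    by (rule indep_var_integrable[OF ind int int'])
  have "expectation (\<lambda>\<omega>. indicator {c} (r t \<omega>)) =
      expectation (indicator {\<omega> \<in> space M. r t \<omega> = c} :: _ \<Rightarrow> real)"
    by (intro Bochner_Integration.integral_cong) (auto simp: indicator_def)
  then show "expectation (\<lambda>\<omega>. V (\<lambda>i. r i \<omega>) * indicator {c} (r t \<omega>)) =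
           expectation (\<lambda>\<omega>. V (\<lambda>i. r i \<omega>)) * prob {\<omega> \<in> space M. r t \<omega> = c}"
    by (subst indep_var_lebesgue_integral[OF ind int int']) simp
qed

text \<open>Optional stopping at a bounded time: the increment of \<open>Z\<close> vanishes once the
  game is over and otherwise has mean zero by \<open>harmonic\<close>. The \<open>max 0\<close>
  encodes that an empty pile stays empty when a chip is to be removed.\<close>

lemma expectation_stopped:
  fixes G :: "nat \<Rightarrow> int \<Rightarrow> real" and n s :: nat
  assumes "s \<le> n"
    and harmonic: "\<And>t x. 0 \<le> x \<Longrightarrow> x < int n \<Longrightarrow>
      G t x = p * G (Suc t) (x + 1) + (1 - p) * G (Suc t) (max 0 (x - 1))"
  defines "Z \<equiv> \<lambda>t \<omega>. G (stopped_time n s (\<lambda>i. r i \<omega>) t)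
                          (chips (\<lambda>i. r i \<omega>) s (stopped_time n s (\<lambda>i. r i \<omega>) t))"
  shows "integrable M (Z t)" and "expectation (Z t) = G 0 (int s)"
proof -
  have "integrable M (Z t) \<and> expectation (Z t) = G 0 (int s)"
  proof (induction t)
    case 0
    have "Z 0 = (\<lambda>\<omega>. G 0 (int s))" by (simp add: Z_def fun_eq_iff stopped_time_0)
    then show ?case by (simp add: prob_space)
  next
    case (Suc t)
    define V where "V = (\<lambda>(g :: int \<Rightarrow> real) \<rho>.
      if (\<forall>i\<le>t. chips \<rho> s i \<noteq> int n) \<and> chips \<rho> s t \<in> {0..int n} then g (chips \<rho> s t) else 0)"
    define g1 where "g1 = (\<lambda>x. G (Suc t) (x + 1) - G t x)"
    define g2 where "g2 = (\<lambda>x. G (Suc t) (max 0 (x - 1)) - G t x)"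
    \<comment> \<open>\<open>W\<close> is the increment of \<open>Z\<close> in turn
      \<open>t + 1\<close>, split by the choice made. Each summand is a function of the past times
      an indicator of the next choice, so its expectation factors.\<close>
    define W where "W = (\<lambda>\<omega>. V g1 (\<lambda>i. r i \<omega>) * indicator {1} (r t \<omega>)
                            + V g2 (\<lambda>i. r i \<omega>) * indicator {-1} (r t \<omega>))"
    have V: "integrable M (\<lambda>\<omega>. V g (\<lambda>i. r i \<omega>))"
      "integrable M (\<lambda>\<omega>. V g (\<lambda>i. r i \<omega>) * indicator {c} (r t \<omega>))"
      "expectation (\<lambda>\<omega>. V g (\<lambda>i. r i \<omega>) * indicator {c} (r t \<omega>)) =
        expectation (\<lambda>\<omega>. V g (\<lambda>i. r i \<omega>)) * prob {\<omega> \<in> space M. r t \<omega> = c}" for g c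
      unfolding V_def by (rule expectation_running_mult_choice)+
    have W: "integrable M W" unfolding W_def by (intro Bochner_Integration.integrable_add V)
    have "expectation W = expectation (\<lambda>\<omega>. V g1 (\<lambda>i. r i \<omega>)) * p
        + expectation (\<lambda>\<omega>. V g2 (\<lambda>i. r i \<omega>)) * (1 - p)"
      unfolding W_def
      by (subst Bochner_Integration.integral_add) (auto simp: V prob_add prob_remove)
    also have "\<dots> = expectation (\<lambda>\<omega>. V g1 (\<lambda>i. r i \<omega>) * p + V g2 (\<lambda>i. r i \<omega>) * (1 - p))"
      by (subst Bochner_Integration.integral_add) (auto intro!: V)
    also have "\<dots> = expectation (\<lambda>\<omega>. 0)"
    proof (intro Bochner_Integration.integral_cong refl)
      fix \<omega>
      \<comment> \<open>A game running after turn \<open>t\<close> excludes pile size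
        \<open>n\<close> at time \<open>t\<close> itself, so \<open>V\<close> is nonzero only
        strictly below the target, where \<open>harmonic\<close> applies.\<close>
      have "g1 x * p + g2 x * (1 - p) = 0" if "0 \<le> x" "x < int n" for x
        using harmonic[OF that, of t] by (simp add: g1_def g2_def algebra_simps)
      then show "V g1 (\<lambda>i. r i \<omega>) * p + V g2 (\<lambda>i. r i \<omega>) * (1 - p) = 0"
        by (auto simp: V_def)
    qed
    finally have EW: "expectation W = 0" by simp
    have "AE \<omega> in M. Z (Suc t) \<omega> = Z t \<omega> + W \<omega>"
      using AE_choices
    proof eventually_elim
      case (elim \<omega>)
      define \<rho> where "\<rho> = (\<lambda>i. r i \<omega>)"
      have \<rho>: "\<rho> i \<in> {1, -1}" for i using elim by (auto simp: \<rho>_def)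
      show ?case
      proof (cases "enat t < game_turns n s \<rho>")
        case True
        then have run: "\<forall>i\<le>t. chips \<rho> s i \<noteq> int n" by (simp add: less_game_turns_iff)
        have "enat (Suc t) \<le> game_turns n s \<rho>" using True by (simp add: Suc_ile_eq)
        then have st: "stopped_time n s \<rho> t = t" "stopped_time n s \<rho> (Suc t) = Suc t"
          using True by (auto intro!: stopped_time_running)
        have "0 \<le> chips \<rho> s t" by (rule chips_nonneg[OF \<rho>])
        moreover have "chips \<rho> s t < int n"
          by (rule chips_less_target[OF \<rho> \<open>s \<le> n\<close>]) (use run in auto)
        ultimately show ?thesis
          using run st \<rho>[of t]
          by (auto simp: Z_def W_def V_def g1_def g2_def max_def
              simp flip: \<rho>_def fun_cong[OF \<rho>_def])
      next
        case False
        then obtain u where u: "game_turns n s \<rho> = enat u" "u \<le> t"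
          by (cases "game_turns n s \<rho>") auto
        have "stopped_time n s \<rho> t = u" "stopped_time n s \<rho> (Suc t) = u"
          using stopped_time_finished[OF u(1)] u(2) by auto
        moreover have "\<not> (\<forall>i\<le>t. chips \<rho> s i \<noteq> int n)"
          using False less_game_turns_iff by blast
        ultimately show ?thesis
          by (auto simp: Z_def W_def V_def simp flip: \<rho>_def)
      qed
    qed
    moreover have "integrable M (\<lambda>\<omega>. Z t \<omega> + W \<omega>)"
      using Suc W by auto
    moreover have "expectation (\<lambda>\<omega>. Z t \<omega> + W \<omega>) = G 0 (int s)"
      using Suc W EW by simp
    moreover have "Z (Suc t) \<in> borel_measurable M"
    proof -
      \<comment> \<open>The pile is evaluated at a random time, which takes countably many
        values.\<close>
      have [measurable]: "(\<lambda>\<omega>. chips (\<lambda>i. r i \<omega>) s (stopped_time n s (\<lambda>i. r i \<omega>) (Suc t)))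
          \<in> M \<rightarrow>\<^sub>M count_space UNIV"
        by (rule measurable_compose_countable[where f = "\<lambda>i \<omega>. chips (\<lambda>i. r i \<omega>) s i"]) auto
      show ?thesis unfolding Z_def by measurable
    qed
    ultimately show ?case
      using integrable_cong_AE[of "Z (Suc t)" M "\<lambda>\<omega>. Z t \<omega> + W \<omega>"]
        integral_cong_AE[of "Z (Suc t)" M "\<lambda>\<omega>. Z t \<omega> + W \<omega>"] by auto
  qed
  then show "integrable M (Z t)" and "expectation (Z t) = G 0 (int s)" by auto
qed

text \<open>A verification principle: a guessed \<open>G\<close> is certified by its properties, so
  no recursion has to be solved. \<open>lower\<close> bounds the powers of the stopped time in
  expectation, and \<open>upper\<close> supplies the dominating function.\<close>

lemma moment_num_turns:
  fixes G :: "nat \<Rightarrow> int \<Rightarrow> real" and n s :: nat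
  assumes "s \<le> n" "0 < k"
    and harmonic: "\<And>t x. 0 \<le> x \<Longrightarrow> x < int n \<Longrightarrow>
      G t x = p * G (Suc t) (x + 1) + (1 - p) * G (Suc t) (max 0 (x - 1))"
    and target: "\<And>t. G t (int n) = real t ^ k"
    and lower: "\<And>t x. 0 \<le> x \<Longrightarrow> x \<le> int n \<Longrightarrow> real t ^ k \<le> G t x"
    and upper: "\<And>t x. 0 \<le> x \<Longrightarrow> x \<le> int n \<Longrightarrow> G t x \<le> B * (1 + real t ^ k)"
  shows "AE \<omega> in M. game_turns n s (\<lambda>t. r t \<omega>) \<noteq> \<infinity>"
    and "integrable M (\<lambda>\<omega>. num_turns n s r \<omega> ^ k)"
    and "expectation (\<lambda>\<omega>. num_turns n s r \<omega> ^ k) = G 0 (int s)"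
proof -
  define \<sigma> where "\<sigma> = (\<lambda>t \<omega>. stopped_time n s (\<lambda>i. r i \<omega>) t)"
  define Z where "Z = (\<lambda>t \<omega>. G (\<sigma> t \<omega>) (chips (\<lambda>i. r i \<omega>) s (\<sigma> t \<omega>)))"
  define Y where "Y = (\<lambda>t \<omega>. real (\<sigma> t \<omega>) ^ k)"
  define T where "T = (\<lambda>\<omega>. game_turns n s (\<lambda>i. r i \<omega>))"
  have [measurable]: "\<sigma> t \<in> M \<rightarrow>\<^sub>M count_space UNIV" for t unfolding \<sigma>_def by measurable
  have [measurable]: "T \<in> M \<rightarrow>\<^sub>M count_space UNIV" unfolding T_def by measurable
  have Zint: "integrable M (Z t)" and EZ: "expectation (Z t) = G 0 (int s)" for t
    unfolding Z_def \<sigma>_def by (rule expectation_stopped[where G = G, OF \<open>s \<le> n\<close> harmonic]; assumption)+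
  have Yint: "integrable M (Y t)" for t
    unfolding Y_def
    by (rule integrable_const_bound[where B = "real t ^ k"])
      (auto simp: \<sigma>_def intro!: power_mono stopped_time_le)
  have range: "AE \<omega> in M. \<forall>t. chips (\<lambda>i. r i \<omega>) s (\<sigma> t \<omega>) \<in> {0..int n}"
    using AE_choices
  proof eventually_elim
    case (elim \<omega>)
    then show ?case unfolding \<sigma>_def
      using chips_stopped_time_range[of "\<lambda>i. r i \<omega>", OF _ \<open>s \<le> n\<close>] by blast
  qed
  have EY: "expectation (Y t) \<le> G 0 (int s)" for t
  proof -
    have "AE \<omega> in M. Y t \<omega> \<le> Z t \<omega>"
      using range by eventually_elim (auto simp: Y_def Z_def intro!: lower)
    then have "expectation (Y t) \<le> expectation (Z t)"
      by (intro integral_mono_AE Yint Zint)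
    then show ?thesis by (simp add: EZ)
  qed
  \<comment> \<open>On endless games the stopped time at \<open>t\<close> is \<open>t\<close>
    itself, so positive probability would make the expectation of \<open>Y t\<close> unbounded,
    against \<open>EY\<close>.\<close>
  have "prob {\<omega> \<in> space M. T \<omega> = \<infinity>} = 0"
  proof (rule ccontr)
    assume "prob {\<omega> \<in> space M. T \<omega> = \<infinity>} \<noteq> 0"
    then have pos: "prob {\<omega> \<in> space M. T \<omega> = \<infinity>} > 0" by (simp add: zero_less_measure_iff)
    obtain t where t: "G 0 (int s) < real t * prob {\<omega> \<in> space M. T \<omega> = \<infinity>}"
      using reals_Archimedean3[OF pos] by auto
    \<comment> \<open>Passing to \<open>Suc t\<close> makes the base at least 1, as
      \<open>self_le_power\<close> requires.\<close>
    have "real (Suc t) * prob {\<omega> \<in> space M. T \<omega> = \<infinity>} =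
        expectation (\<lambda>\<omega>. real (Suc t) * indicator {\<omega> \<in> space M. T \<omega> = \<infinity>} \<omega>)"
      by simp
    also have "\<dots> \<le> expectation (Y (Suc t))"
    proof (rule integral_mono)
      fix \<omega>
      have "\<sigma> (Suc t) \<omega> = Suc t" if "T \<omega> = \<infinity>"
        using that by (auto simp: \<sigma>_def T_def intro!: stopped_time_running)
      then show "real (Suc t) * indicator {\<omega> \<in> space M. T \<omega> = \<infinity>} \<omega> \<le> Y (Suc t) \<omega>"
        using \<open>0 < k\<close> self_le_power[of "real (Suc t)" k] by (auto simp: Y_def indicator_def)
    qed (auto intro!: Yint integrable_real_indicator simp: less_top[symmetric])
    also have "\<dots> \<le> G 0 (int s)" by (rule EY)
    finally show False using t pos by (simp add: algebra_simps)
  qed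
  then have "AE \<omega> in M. T \<omega> \<noteq> \<infinity>"
    using prob_eq_0[of "{\<omega> \<in> space M. T \<omega> = \<infinity>}"] by auto
  then show fin: "AE \<omega> in M. game_turns n s (\<lambda>t. r t \<omega>) \<noteq> \<infinity>" by (simp add: T_def)
  \<comment> \<open>Once the game is over nothing changes, so the limits of \<open>Y\<close> and
    \<open>Z\<close> below are eventual equalities.\<close>
  have ev: "AE \<omega> in M. \<forall>\<^sub>F t in sequentially. real (\<sigma> t \<omega>) = num_turns n s r \<omega> \<and>
      chips (\<lambda>i. r i \<omega>) s (\<sigma> t \<omega>) = int n"
    using fin
  proof eventually_elim
    case (elim \<omega>)
    then obtain u where u: "game_turns n s (\<lambda>i. r i \<omega>) = enat u" by auto
    show ?case
      using eventually_ge_at_top[of u]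
      by eventually_elim
        (use chips_game_turns[OF u] stopped_time_finished[OF u] u in \<open>auto simp: \<sigma>_def num_turns_def\<close>)
  qed
  have \<sigma>mono: "mono (\<lambda>t. \<sigma> t \<omega>)" for \<omega>
    unfolding \<sigma>_def by (rule stopped_time_mono)
  have Ymono: "mono (\<lambda>t. Y t \<omega>)" for \<omega>
    using \<sigma>mono[of \<omega>] by (auto simp: Y_def mono_def intro!: power_mono)
  have "incseq (\<lambda>t. expectation (Y t))"
    by (intro incseq_SucI integral_mono Yint) (use Ymono in \<open>auto simp: mono_def\<close>)
  then obtain L where L: "(\<lambda>t. expectation (Y t)) \<longlonglongrightarrow> L"
    using incseq_convergent[of "\<lambda>t. expectation (Y t)" "G 0 (int s)"] EY by blast
  have Ylim: "AE \<omega> in M. (\<lambda>t. Y t \<omega>) \<longlonglongrightarrow> num_turns n s r \<omega> ^ k"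
    using ev
  proof eventually_elim
    case (elim \<omega>)
    show ?case
      by (rule tendsto_eventually) (use elim in eventually_elim, auto simp: Y_def)
  qed
  show Xint: "integrable M (\<lambda>\<omega>. num_turns n s r \<omega> ^ k)"
    by (rule integrable_monotone_convergence[OF Yint _ Ylim L]) (use Ymono in auto)
  have "(\<lambda>t. expectation (Z t)) \<longlonglongrightarrow> expectation (\<lambda>\<omega>. num_turns n s r \<omega> ^ k)"
  proof (rule integral_dominated_convergence)
    show "integrable M (\<lambda>\<omega>. B * (1 + num_turns n s r \<omega> ^ k))"
      using Xint by auto
    show "AE \<omega> in M. (\<lambda>t. Z t \<omega>) \<longlonglongrightarrow> num_turns n s r \<omega> ^ k"
      using ev
    proof eventually_elim
      case (elim \<omega>)
      show ?case
        by (rule tendsto_eventually) (use elim in eventually_elim, auto simp: Z_def target)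
    qed
    fix t
    \<comment> \<open>At \<open>t = 0\<close> and \<open>x = 0\<close> the two bounds read
      \<open>0 \<le> G 0 0 \<le> B\<close>, because \<open>0 ^ k = 0\<close> for positive
      \<open>k\<close>.\<close>
    have "B \<ge> 0"
      using order_trans[OF lower upper, of 0 0] \<open>0 < k\<close> by (simp add: power_0_left)
    show "AE \<omega> in M. norm (Z t \<omega>) \<le> B * (1 + num_turns n s r \<omega> ^ k)"
      using range fin
    proof eventually_elim
      case (elim \<omega>)
      then obtain u where u: "game_turns n s (\<lambda>i. r i \<omega>) = enat u" by auto
      have "\<sigma> t \<omega> \<le> u" using u by (auto simp: \<sigma>_def stopped_time_def min_def)
      then have "real (\<sigma> t \<omega>) ^ k \<le> num_turns n s r \<omega> ^ k"
        using u by (auto simp: num_turns_def intro!: power_mono)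
      then have "B * (1 + real (\<sigma> t \<omega>) ^ k) \<le> B * (1 + num_turns n s r \<omega> ^ k)"
        using \<open>B \<ge> 0\<close> by (intro mult_left_mono) auto
      moreover have "Z t \<omega> \<le> B * (1 + real (\<sigma> t \<omega>) ^ k)"
        unfolding Z_def using elim by (intro upper) auto
      moreover have "0 \<le> Z t \<omega>"
        unfolding Z_def using elim by (intro order_trans[OF _ lower]) auto
      ultimately show ?case by simp
    qed
  qed (use Zint in auto)
  \<comment> \<open>The expectations of \<open>Z t\<close> are constantly
    \<open>G 0 (int s)\<close>, so this is also their limit.\<close>
  then show "expectation (\<lambda>\<omega>. num_turns n s r \<omega> ^ k) = G 0 (int s)"
    by (simp add: EZ LIMSEQ_const_iff)
qed

end


section \<open>The symmetric walk: closed forms for the first three moments\<close>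

theorem proposition6:
  fixes M :: "'a measure" and r :: "nat \<Rightarrow> 'a \<Rightarrow> int" and n s :: nat
    and X :: "'a \<Rightarrow> real" and \<mu> :: real
  assumes game: "pile_game M (1/2) r"
    and "s \<le> n"
  defines "X \<equiv> num_turns n s r"
    and "\<mu> \<equiv> prob_space.expectation M X"
  shows "(AE \<omega> in M. game_turns n s (\<lambda>t. r t \<omega>) \<noteq> \<infinity>) \<and>
    integrable M X \<and>
    integrable M (\<lambda>\<omega>. (X \<omega> - \<mu>) ^ 2) \<and>
    integrable M (\<lambda>\<omega>. (X \<omega> - \<mu>) ^ 3) \<and>
    prob_space.variance M X = prob_space.expectation M (\<lambda>\<omega>. (X \<omega> - \<mu>) ^ 2) \<and>
    prob_space.expectation M (\<lambda>\<omega>. (X \<omega> - \<mu>) ^ 2) =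
      (real n - real s) * (real n + real s + 1) *
      (2 * real n ^ 2 + 2 * real n + 2 * real s ^ 2 + 2 * real s - 1) / 3 \<and>
    prob_space.expectation M (\<lambda>\<omega>. (X \<omega> - \<mu>) ^ 3) =
      (real n - real s) * (real n + real s + 1) / 15 *
      (16 * real n ^ 4 + 32 * real n ^ 3 + 8 * real n ^ 2 * (2 * real s ^ 2 + 2 * real s + 1)
        + 8 * real n * (2 * real s ^ 2 + 2 * real s - 1)
        + 16 * real s ^ 4 + 32 * real s ^ 3 + 8 * real s ^ 2 - 8 * real s - 3)"
proof -
  interpret pile_game M "1/2" r by (rule game)
  \<comment> \<open>The reflection at \<open>0\<close> makes everything symmetric under \<open>x \<mapsto> -1 - x\<close>, so all moments are
    polynomials in \<open>x * (x + 1)\<close>: \<open>m1\<close>, \<open>m2\<close>, \<open>m3\<close> are the raw moments, \<open>v\<close> and \<open>k3\<close> the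
    central ones.\<close>
  define N where "N = real n * (real n + 1)"
  define w where "w = (\<lambda>x. real_of_int x * (real_of_int x + 1))"
  define m1 where "m1 = (\<lambda>x. N - w x)"
  define v where "v = (\<lambda>x. (N - w x) * (2 * N + 2 * w x - 1) / 3)"
  define k3 where "k3 = (\<lambda>x. (N - w x) / 15 *
    (16 * N\<^sup>2 + 16 * N * w x + 16 * (w x)\<^sup>2 - 8 * N - 8 * w x - 3))"
  define m2 where "m2 = (\<lambda>x. v x + (m1 x)\<^sup>2)"
  define m3 where "m3 = (\<lambda>x. k3 x + 3 * m1 x * v x + m1 x ^ 3)"
  define G1 where "G1 = (\<lambda>(t::nat) x. real t + m1 x)"
  define G2 where "G2 = (\<lambda>(t::nat) x. real t ^ 2 + 2 * real t * m1 x + m2 x)"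
  define G3 where "G3 = (\<lambda>(t::nat) x.
    real t ^ 3 + 3 * real t ^ 2 * m1 x + 3 * real t * m2 x + m3 x)"
  note defs = G1_def G2_def G3_def m3_def m2_def m1_def v_def k3_def
  \<comment> \<open>Since \<open>w (-1) = w 0 = 0\<close>, the boundary rule disappears and the
    moments satisfy the recursion of the unrestricted walk.\<close>
  have w_max: "w (max 0 (x - 1)) = w (x - 1)" if "0 \<le> x" for x
    using that by (cases "x = 0") (auto simp: w_def)
  have max_eq: "m1 (max 0 (x - 1)) = m1 (x - 1)" "m2 (max 0 (x - 1)) = m2 (x - 1)"
    "m3 (max 0 (x - 1)) = m3 (x - 1)" if "0 \<le> x" for x
    using w_max[OF that] by (simp_all add: m3_def m2_def m1_def v_def k3_def)
  have wn: "w (int n) = N" by (simp add: w_def N_def)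
  \<comment> \<open>One turn later the remaining time is \<open>T - 1\<close>, so the values at the
    two neighbours average to the expectation of \<open>(T - 1) ^ k\<close>. The right-hand sides of
    \<open>h1\<close>, \<open>h2\<close>, \<open>h3\<close> are twice its binomial
    expansion.\<close>
  have h1: "m1 (x + 1) + m1 (x - 1) = 2 * m1 x - 2" for x
    by (simp add: m1_def w_def algebra_simps)
  have h2: "m2 (x + 1) + m2 (x - 1) = 2 * m2 x - 4 * m1 x + 2" for x
    unfolding m2_def m1_def v_def w_def of_int_add of_int_diff of_int_1
    by (simp add: field_simps) algebra
  have h3: "m3 (x + 1) + m3 (x - 1) = 2 * m3 x - 6 * m2 x + 6 * m1 x - 2" for x
    unfolding m3_def m2_def m1_def v_def k3_def w_def of_int_add of_int_diff of_int_1
    by (simp add: field_simps) algebra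
  have nonneg: "0 \<le> m1 x" "0 \<le> v x" "0 \<le> k3 x" if x: "0 \<le> x" "x \<le> int n" for x
  proof -
    have w0: "0 \<le> w x" using x by (simp add: w_def)
    have "real_of_int x \<le> real n" using x by linarith
    then have wN: "w x \<le> N" unfolding w_def N_def using x by (intro mult_mono) auto
    then show "0 \<le> m1 x" by (simp add: m1_def)
    show "0 \<le> v x" "0 \<le> k3 x"
    proof -
      \<comment> \<open>For \<open>n = 0\<close> the last factors of \<open>v\<close> and
        \<open>k3\<close> are negative, but \<open>N - w x\<close> is zero. For
        \<open>n \<ge> 1\<close> the bound \<open>2 \<le> N\<close> makes them nonnegative.\<close>
      consider "n = 0" | "n \<ge> 1" by linarith
      then have "0 \<le> v x \<and> 0 \<le> k3 x"
      proof cases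
        case 1
        then have "x = 0" using x by simp
        then show ?thesis using 1 by (simp add: v_def k3_def w_def N_def)
      next
        case 2
        then have "1 * 2 \<le> N" unfolding N_def by (intro mult_mono) auto
        then have N2: "2 \<le> N" by simp
        have "0 \<le> 2 * N + 2 * w x - 1" using N2 w0 by simp
        then have "0 \<le> v x" using wN by (simp add: v_def)
        \<comment> \<open>Splitting off multiples of \<open>N - 2\<close> leaves nonnegative
          products and a remainder that is linear in \<open>N\<close> and
          \<open>w x\<close>.\<close>
        have "0 \<le> (N - 2) * N" "0 \<le> (N - 2) * w x" "0 \<le> (w x)\<^sup>2" using N2 w0 by auto
        moreover have "16 * N\<^sup>2 + 16 * N * w x + 16 * (w x)\<^sup>2 - 8 * N - 8 * w x - 3 =
            16 * ((N - 2) * N) + 16 * ((N - 2) * w x) + 16 * (w x)\<^sup>2 + 24 * N + 24 * w x - 3"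
          by (simp add: algebra_simps power2_eq_square)
        ultimately have "0 \<le> 16 * N\<^sup>2 + 16 * N * w x + 16 * (w x)\<^sup>2 - 8 * N - 8 * w x - 3"
          using N2 w0 by linarith
        then have "0 \<le> k3 x" unfolding k3_def using wN by (intro mult_nonneg_nonneg) auto
        with \<open>0 \<le> v x\<close> show ?thesis by simp
      qed
      then show "0 \<le> v x" "0 \<le> k3 x" by auto
    qed
  qed
  have nonneg': "0 \<le> m2 x" "0 \<le> m3 x" if "0 \<le> x" "x \<le> int n" for x
    using nonneg[OF that] by (auto simp: m2_def m3_def)
  \<comment> \<open>The coefficients 3, 3, 1 dominate the binomial coefficients for \<open>k\<close>
    = 1, 2 and 3, so one constant serves all three moments.\<close>
  define B where "B = 1 + (\<Sum>x\<in>{0..int n}. 3 * m1 x + 3 * m2 x + m3 x)"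
  have B: "1 + 3 * m1 x + 3 * m2 x + m3 x \<le> B" if "0 \<le> x" "x \<le> int n" for x
    using member_le_sum[of x "{0..int n}" "\<lambda>x. 3 * m1 x + 3 * m2 x + m3 x"] that nonneg nonneg'
    by (auto simp: B_def)
  \<comment> \<open>The summand 1 covers \<open>t = 0\<close>, where \<open>0 ^ 0 = 1\<close> may
    exceed \<open>0 ^ k\<close>.\<close>
  have pow_le: "real t ^ i \<le> 1 + real t ^ k" if "i \<le> k" for t i k
    using that power_increasing[of i k "real t"] by (cases "t = 0") (auto simp: power_0_left)
  have coeff: "real t ^ i * a \<le> (1 + real t ^ k) * a" if "i \<le> k" "0 \<le> a" for t i k a
    using pow_le[OF that(1), of t] that(2) by (intro mult_right_mono)
  have up: "(1 + real t ^ k) * c \<le> B * (1 + real t ^ k)" if "c \<le> B" for c t k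
    using mult_left_mono[OF that, of "1 + real t ^ k"] by (simp add: mult.commute)

  \<comment> \<open>The raw moments of orders 1, 2 and 3\<close>
  have E1: "AE \<omega> in M. game_turns n s (\<lambda>t. r t \<omega>) \<noteq> \<infinity>"
    "integrable M (\<lambda>\<omega>. X \<omega> ^ 1)" "expectation (\<lambda>\<omega>. X \<omega> ^ 1) = G1 0 (int s)"
  proof -
    have 1: "G1 t x = 1/2 * G1 (Suc t) (x + 1) + (1 - 1/2) * G1 (Suc t) (max 0 (x - 1))"
      if "0 \<le> x" for t x
      using h1[of x] by (simp add: G1_def max_eq[OF that] field_simps)
    have 2: "G1 t (int n) = real t ^ 1" for t by (simp add: defs wn)
    have 3: "real t ^ 1 \<le> G1 t x" if "0 \<le> x" "x \<le> int n" for t x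
      using nonneg[OF that] by (simp add: G1_def)
    have 4: "G1 t x \<le> B * (1 + real t ^ 1)" if "0 \<le> x" "x \<le> int n" for t x
    proof -
      \<comment> \<open>Every term is written as a power of \<open>t\<close> times a nonnegative
        coefficient, so that \<open>coeff\<close> applies term by term; the later orders follow the
        same pattern.\<close>
      have "G1 t x = real t ^ 1 * 1 + real t ^ 0 * m1 x"
        by (simp add: G1_def)
      also have "\<dots> \<le> (1 + real t ^ 1) * 1 + (1 + real t ^ 1) * m1 x"
        using nonneg[OF that] nonneg'[OF that] by (intro add_mono coeff) auto
      also have "\<dots> = (1 + real t ^ 1) * (1 + m1 x)"
        by (simp only: distrib_left)
      also have "\<dots> \<le> B * (1 + real t ^ 1)"
        using B[OF that] nonneg[OF that] nonneg'[OF that] by (intro up) simp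
      finally show ?thesis .
    qed
    note mom = moment_num_turns[where G = G1 and k = 1, OF \<open>s \<le> n\<close> zero_less_one 1 2 3 4, folded X_def]
    show "AE \<omega> in M. game_turns n s (\<lambda>t. r t \<omega>) \<noteq> \<infinity>"
      "integrable M (\<lambda>\<omega>. X \<omega> ^ 1)" "expectation (\<lambda>\<omega>. X \<omega> ^ 1) = G1 0 (int s)"
      using mom by blast+
  qed
  have E2: "integrable M (\<lambda>\<omega>. X \<omega> ^ 2)" "expectation (\<lambda>\<omega>. X \<omega> ^ 2) = G2 0 (int s)"
  proof -
    have 1: "G2 t x = 1/2 * G2 (Suc t) (x + 1) + (1 - 1/2) * G2 (Suc t) (max 0 (x - 1))"
      if "0 \<le> x" for t x
    proof -
      \<comment> \<open>Grouping the neighbours' moments into sums lets \<open>h1\<close> and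
        \<open>h2\<close> replace them, which leaves a polynomial identity in \<open>t\<close> and
        the moments at \<open>x\<close>.\<close>
      have "G2 (Suc t) (x + 1) + G2 (Suc t) (x - 1) = 2 * real (Suc t) ^ 2 +
          2 * real (Suc t) * (m1 (x + 1) + m1 (x - 1)) + (m2 (x + 1) + m2 (x - 1))"
        by (simp add: G2_def algebra_simps)
      also have "\<dots> = 2 * G2 t x"
        unfolding h1 h2 G2_def of_nat_Suc by algebra
      finally have "G2 (Suc t) (x + 1) + G2 (Suc t) (x - 1) = 2 * G2 t x" .
      moreover have "G2 (Suc t) (max 0 (x - 1)) = G2 (Suc t) (x - 1)"
        by (simp add: G2_def max_eq[OF that])
      ultimately show ?thesis by simp
    qed
    have 2: "G2 t (int n) = real t ^ 2" for t by (simp add: defs wn)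
    have 3: "real t ^ 2 \<le> G2 t x" if "0 \<le> x" "x \<le> int n" for t x
      using nonneg[OF that] nonneg'[OF that] by (simp add: G2_def)
    have 4: "G2 t x \<le> B * (1 + real t ^ 2)" if "0 \<le> x" "x \<le> int n" for t x
    proof -
      have "G2 t x = real t ^ 2 * 1 + real t ^ 1 * (2 * m1 x) + real t ^ 0 * m2 x"
        by (simp add: G2_def)
      also have "\<dots> \<le> (1 + real t ^ 2) * 1 + (1 + real t ^ 2) * (2 * m1 x) + (1 + real t ^ 2) * m2 x"
        using nonneg[OF that] nonneg'[OF that] by (intro add_mono coeff) auto
      also have "\<dots> = (1 + real t ^ 2) * (1 + 2 * m1 x + m2 x)"
        by (simp only: distrib_left)
      also have "\<dots> \<le> B * (1 + real t ^ 2)"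
        using B[OF that] nonneg[OF that] nonneg'[OF that] by (intro up) simp
      finally show ?thesis .
    qed
    note mom = moment_num_turns[where G = G2 and k = 2, OF \<open>s \<le> n\<close> zero_less_numeral 1 2 3 4, folded X_def]
    show "integrable M (\<lambda>\<omega>. X \<omega> ^ 2)" "expectation (\<lambda>\<omega>. X \<omega> ^ 2) = G2 0 (int s)"
      using mom by blast+
  qed
  have E3: "integrable M (\<lambda>\<omega>. X \<omega> ^ 3)" "expectation (\<lambda>\<omega>. X \<omega> ^ 3) = G3 0 (int s)"
  proof -
    have 1: "G3 t x = 1/2 * G3 (Suc t) (x + 1) + (1 - 1/2) * G3 (Suc t) (max 0 (x - 1))"
      if "0 \<le> x" for t x
    proof -
      have "G3 (Suc t) (x + 1) + G3 (Suc t) (x - 1) = 2 * real (Suc t) ^ 3 +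
          3 * real (Suc t) ^ 2 * (m1 (x + 1) + m1 (x - 1)) +
          3 * real (Suc t) * (m2 (x + 1) + m2 (x - 1)) + (m3 (x + 1) + m3 (x - 1))"
        by (simp add: G3_def algebra_simps)
      also have "\<dots> = 2 * G3 t x"
        unfolding h1 h2 h3 G3_def of_nat_Suc by algebra
      finally have "G3 (Suc t) (x + 1) + G3 (Suc t) (x - 1) = 2 * G3 t x" .
      moreover have "G3 (Suc t) (max 0 (x - 1)) = G3 (Suc t) (x - 1)"
        by (simp add: G3_def max_eq[OF that])
      ultimately show ?thesis by simp
    qed
    have 2: "G3 t (int n) = real t ^ 3" for t by (simp add: defs wn)
    have 3: "real t ^ 3 \<le> G3 t x" if "0 \<le> x" "x \<le> int n" for t x
      using nonneg[OF that] nonneg'[OF that] by (simp add: G3_def)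
    have 4: "G3 t x \<le> B * (1 + real t ^ 3)" if "0 \<le> x" "x \<le> int n" for t x
    proof -
      have "G3 t x = real t ^ 3 * 1 + real t ^ 2 * (3 * m1 x) + real t ^ 1 * (3 * m2 x) + real t ^ 0 * m3 x"
        by (simp add: G3_def)
      also have "\<dots> \<le> (1 + real t ^ 3) * 1 + (1 + real t ^ 3) * (3 * m1 x) + (1 + real t ^ 3) * (3 * m2 x) + (1 + real t ^ 3) * m3 x"
        using nonneg[OF that] nonneg'[OF that] by (intro add_mono coeff) auto
      also have "\<dots> = (1 + real t ^ 3) * (1 + 3 * m1 x + 3 * m2 x + m3 x)"
        by (simp only: distrib_left)
      also have "\<dots> \<le> B * (1 + real t ^ 3)"
        using B[OF that] nonneg[OF that] nonneg'[OF that] by (intro up) simp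
      finally show ?thesis .
    qed
    note mom = moment_num_turns[where G = G3 and k = 3, OF \<open>s \<le> n\<close> zero_less_numeral 1 2 3 4, folded X_def]
    show "integrable M (\<lambda>\<omega>. X \<omega> ^ 3)" "expectation (\<lambda>\<omega>. X \<omega> ^ 3) = G3 0 (int s)"
      using mom by blast+
  qed

  \<comment> \<open>From raw to central moments\<close>
  have int1: "integrable M X" using E1(2) by simp
  have \<mu>: "\<mu> = m1 (int s)" using E1(3) by (simp add: \<mu>_def G1_def)
  have e1: "expectation X = m1 (int s)" using \<mu> by (simp add: \<mu>_def)
  have e2: "expectation (\<lambda>\<omega>. X \<omega> ^ 2) = m2 (int s)" using E2(2) by (simp add: G2_def)
  have e3: "expectation (\<lambda>\<omega>. X \<omega> ^ 3) = m3 (int s)" using E3(2) by (simp add: G3_def)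
  have sq: "(X \<omega> - \<mu>) ^ 2 = X \<omega> ^ 2 - 2 * \<mu> * X \<omega> + \<mu> ^ 2" for \<omega>
    by (simp add: power2_eq_square algebra_simps)
  have cube: "(X \<omega> - \<mu>) ^ 3 = X \<omega> ^ 3 - 3 * \<mu> * X \<omega> ^ 2 + 3 * \<mu> ^ 2 * X \<omega> - \<mu> ^ 3" for \<omega>
    by (simp add: power2_eq_square power3_eq_cube algebra_simps)
  have "expectation (\<lambda>\<omega>. (X \<omega> - \<mu>) ^ 2) = m2 (int s) - 2 * \<mu> * \<mu> + \<mu> ^ 2"
    unfolding sq using int1 E2(1) by (simp add: e1 e2 prob_space \<mu>)
  also have "\<dots> = v (int s)"
    by (simp add: \<mu> m2_def power2_eq_square)
  finally have c2: "expectation (\<lambda>\<omega>. (X \<omega> - \<mu>) ^ 2) = v (int s)" .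
  have "expectation (\<lambda>\<omega>. (X \<omega> - \<mu>) ^ 3) =
      m3 (int s) - 3 * \<mu> * m2 (int s) + 3 * \<mu> ^ 2 * \<mu> - \<mu> ^ 3"
    unfolding cube using int1 E2(1) E3(1) by (simp add: e1 e2 e3 prob_space \<mu>)
  also have "\<dots> = k3 (int s)"
    by (simp add: \<mu> m3_def m2_def power2_eq_square power3_eq_cube algebra_simps)
  finally have c3: "expectation (\<lambda>\<omega>. (X \<omega> - \<mu>) ^ 3) = k3 (int s)" .
  have "integrable M (\<lambda>\<omega>. (X \<omega> - \<mu>) ^ 2)" "integrable M (\<lambda>\<omega>. (X \<omega> - \<mu>) ^ 3)"
    unfolding sq cube using int1 E2(1) E3(1) by auto
  \<comment> \<open>The linear factor comes from \<open>N - w (int s)\<close>, which factors as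
    \<open>(n - s) * (n + s + 1)\<close>.\<close>
  moreover have "v (int s) = (real n - real s) * (real n + real s + 1) *
      (2 * real n ^ 2 + 2 * real n + 2 * real s ^ 2 + 2 * real s - 1) / 3"
    unfolding v_def N_def w_def of_int_of_nat_eq by algebra
  moreover have "k3 (int s) = (real n - real s) * (real n + real s + 1) / 15 *
      (16 * real n ^ 4 + 32 * real n ^ 3 + 8 * real n ^ 2 * (2 * real s ^ 2 + 2 * real s + 1)
        + 8 * real n * (2 * real s ^ 2 + 2 * real s - 1)
        + 16 * real s ^ 4 + 32 * real s ^ 3 + 8 * real s ^ 2 - 8 * real s - 3)"
    unfolding k3_def N_def w_def of_int_of_nat_eq by algebra
  ultimately show ?thesis
    using E1(1) int1 c2 c3 by (simp add: \<mu>_def)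
qed

end
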